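(* Let $d\ge 2$, $0<a_1\le\dots\le a_d$ be real numbers and $j\in\{1,\dots,d\}$. Let $B_{a_1,\dots,a_d}=\{x\in\mathbb{R}^d:-a_i\le x_i\le a_i,\ i=1,\dots,d\}$ and $X_{a_1,\dots,a_d}=\operatorname{conv}\{\pm a_1e_1,\dots,\pm a_de_d\}\subset\mathbb{R}^d$. Then (i) $R_j(B_{a_1,\dots,a_d})=\sqrt{a_1^2+\dots+a_j^2}$, and (ii) $$r_j(X_{a_1,\dots,a_d})=\frac{\prod_{i=d-j+1}^d a_i}{\sqrt{\sum_{i=d-j+1}^d\ \prod_{l\in\{d-j+1,\dots,d\},\,l\ne i}a_l^2}}.$$
   Context: For a body $C\subset\mathbb{R}^d$ (bounded, closed, convex set with nonempty interior), $1\le j\le d$, and $\mathbb{B}$ the Euclidean unit ball: the inner $j$-radius is $r_j(C)=\max\{\rho\ge0:(q+\rho\mathbb{B})\cap F\subset C\text{ for some }j\text{-dimensional affine subspace }F\text{ and some }q\in F\}$, i.e. the radius of a largest $j$-dimensional ball contained in $C$; the outer $j$-radius is $R_j(C)=\min\{\rho\ge 0: C\subset E+\rho\mathbb{B}\text{ for some }(d-j)\text{-dimensional affine subspace }E\}$, equivalently the smallest radius of a ball containing the orthogonal projection of $C$ onto some $j$-dimensional linear subspace. An empty product equals $1$. *)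

theory Defs
  imports "HOL-Analysis.Analysis"
begin

text \<open>
  Both radii are literally a maximum and a minimum: \<open>GREATEST\<close> and \<open>LEAST\<close> require the extremal
  value to be attained (in contrast to \<open>Sup\<close> and \<open>Inf\<close>). They are meant for
  \<open>1 \<le> j \<le> DIM('a)\<close> and bounded closed convex \<open>C\<close> with nonempty interior.
\<close>

definition inner_radius :: "nat \<Rightarrow> 'a::euclidean_space set \<Rightarrow> real" where
  "inner_radius j C =
     (GREATEST \<rho>. \<rho> \<ge> 0 \<and>
        (\<exists>F q. affine F \<and> aff_dim F = int j \<and> q \<in> F \<and> cball q \<rho> \<inter> F \<subseteq> C))"

definition outer_radius :: "nat \<Rightarrow> 'a::euclidean_space set \<Rightarrow> real" where
  "outer_radius j C =
     (LEAST \<rho>. \<rho> \<ge> 0 \<and>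
        (\<exists>E. affine E \<and> aff_dim E = int DIM('a) - int j \<and>
             C \<subseteq> {x + y |x y. x \<in> E \<and> y \<in> cball 0 \<rho>}))"

text \<open>
  The index type \<open>'n\<close> of \<open>real ^ 'n\<close> carries no order, so the numbering \<open>1, \<dots>, d\<close> of the
  coordinates is an explicit parameter \<open>\<sigma>\<close>, intended to be a bijection from \<open>{1..CARD('n)}\<close> onto
  \<open>'n\<close>: the \<open>i\<close>-th coordinate of \<open>x\<close> is \<open>x $ \<sigma> i\<close> and \<open>e\<^sub>i\<close> is \<open>axis (\<sigma> i) 1\<close>.
\<close>

definition coord_box :: "(nat \<Rightarrow> 'n::finite) \<Rightarrow> (nat \<Rightarrow> real) \<Rightarrow> (real ^ 'n) set" where
  "coord_box \<sigma> a = {x. \<forall>i\<in>{1..CARD('n)}. - a i \<le> x $ \<sigma> i \<and> x $ \<sigma> i \<le> a i}"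

definition cross_polytope :: "(nat \<Rightarrow> 'n::finite) \<Rightarrow> (nat \<Rightarrow> real) \<Rightarrow> (real ^ 'n) set" where
  "cross_polytope \<sigma> a =
     convex hull (\<Union>i\<in>{1..CARD('n)}. {a i *\<^sub>R axis (\<sigma> i) 1, - (a i *\<^sub>R axis (\<sigma> i) 1)})"

end

theory Submission imports Defs
begin

text \<open>
  Let \<open>L\<close> be a linear subspace of dimension \<open>j\<close> and \<open>P\<close> the orthogonal projection onto it. For
  weights \<open>w\<close> there are signs \<open>s\<close> with
  \<open>\<parallel>P (\<Sum>i. s\<^sub>i w\<^sub>i e\<^sub>i)\<parallel>\<^sup>2 \<ge> \<Sum>i. w\<^sub>i\<^sup>2 \<parallel>P e\<^sub>i\<parallel>\<^sup>2\<close>. The numbers \<open>\<parallel>P e\<^sub>i\<parallel>\<^sup>2\<close> lie in \<open>[0, 1]\<close> and add up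
  to \<open>j\<close>, so the right-hand side is at least the sum of the \<open>j\<close> smallest \<open>w\<^sub>i\<^sup>2\<close>. With \<open>w = a\<close> the
  vector is a vertex of the box, and \<open>L\<close> is the orthogonal complement of the direction of the flat
  \<open>E\<close>. With \<open>w = 1 / a\<close> the vector is the normal of a facet of the cross-polytope, and \<open>L\<close> is the
  direction of the flat \<open>F\<close>. Both bodies are symmetric, so balls and flats may be centred at the
  origin, and coordinate subspaces attain both bounds.
\<close>

section \<open>Two extremal inequalities: choice of signs, and weighted sums with bounded
  weights\<close>

text \<open>The signs are chosen greedily. Each new vector gets the sign that makes its inner
  product with the partial sum nonnegative, so the cross term in the expanded square can only
  help.\<close>

lemma ex_signs_sum_norm_le:
  fixes v :: "'i \<Rightarrow> 'a::real_inner"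
  assumes "finite A"
  shows "\<exists>s::'i \<Rightarrow> real. (\<forall>i. \<bar>s i\<bar> = 1) \<and>
           (\<Sum>i\<in>A. (norm (v i))\<^sup>2) \<le> (norm (\<Sum>i\<in>A. s i *\<^sub>R v i))\<^sup>2"
  using assms
proof (induction A rule: finite_induct)
  case empty
  show ?case by (rule exI[of _ "\<lambda>_. 1"]) simp
next
  case (insert k A)
  then obtain s :: "'i \<Rightarrow> real" where s: "\<And>i. \<bar>s i\<bar> = 1"
    "(\<Sum>i\<in>A. (norm (v i))\<^sup>2) \<le> (norm (\<Sum>i\<in>A. s i *\<^sub>R v i))\<^sup>2" by blast
  define S where "S = (\<Sum>i\<in>A. s i *\<^sub>R v i)"
  define t :: real where "t = (if inner S (v k) \<ge> 0 then 1 else - 1)"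
  have t: "\<bar>t\<bar> = 1" "t * inner S (v k) \<ge> 0" by (auto simp: t_def)
  have "(\<Sum>i\<in>A. (s(k := t)) i *\<^sub>R v i) = S"
    unfolding S_def using insert.hyps by (intro sum.cong) auto
  then have "(\<Sum>i\<in>insert k A. (s(k := t)) i *\<^sub>R v i) = t *\<^sub>R v k + S"
    using insert.hyps by simp
  moreover have "(norm (t *\<^sub>R v k + S))\<^sup>2 = (norm (v k))\<^sup>2 + (norm S)\<^sup>2 + 2 * (t * inner S (v k))"
    using dot_norm[of "t *\<^sub>R v k" S] t(1) by (simp add: inner_commute)
  moreover have "(\<Sum>i\<in>insert k A. (norm (v i))\<^sup>2) \<le> (norm (v k))\<^sup>2 + (norm S)\<^sup>2"
    using s(2) insert.hyps by (simp add: S_def)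
  ultimately have "(\<Sum>i\<in>insert k A. (norm (v i))\<^sup>2)
      \<le> (norm (\<Sum>i\<in>insert k A. (s(k := t)) i *\<^sub>R v i))\<^sup>2"
    using t(2) by simp
  moreover have "\<forall>i. \<bar>(s(k := t)) i\<bar> = 1" using s(1) t(1) by simp
  ultimately show ?case by blast
qed

text \<open>Weights in [0,1] of total mass \<open>card T\<close> give the least sum when all mass
  sits on the smallest values. With \<open>e\<close> the indicator of \<open>T\<close>, the factors
  \<open>u i - c\<close> and \<open>p i - e i\<close> never have opposite signs; after summation the
  terms with \<open>c\<close> cancel because \<open>p\<close> and \<open>e\<close> have equal
  mass.\<close>

lemma sum_smallest_le_weighted_sum:
  fixes u p :: "'i \<Rightarrow> real"
  assumes "finite S" "T \<subseteq> S"
    and p: "\<And>i. i \<in> S \<Longrightarrow> 0 \<le> p i" "\<And>i. i \<in> S \<Longrightarrow> p i \<le> 1" "sum p S = card T"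
    and c: "\<And>i. i \<in> T \<Longrightarrow> u i \<le> c" "\<And>i. i \<in> S - T \<Longrightarrow> c \<le> u i"
  shows "sum u T \<le> (\<Sum>i\<in>S. u i * p i)"
proof -
  define e :: "'i \<Rightarrow> real" where "e i = (if i \<in> T then 1 else 0)" for i
  have e: "sum e S = card T" "(\<Sum>i\<in>S. u i * e i) = sum u T"
    using assms(1,2) by (simp_all add: e_def sum.If_cases Int_absorb1 if_distrib cong: if_cong)
  have "0 \<le> (u i - c) * (p i - e i)" if "i \<in> S" for i
  proof (cases "i \<in> T")
    case True
    then show ?thesis using p(2)[OF that] c(1) by (simp add: e_def mult_nonpos_nonpos)
  next
    case False
    then show ?thesis using p(1)[OF that] c(2) that by (simp add: e_def)
  qed
  then have "0 \<le> (\<Sum>i\<in>S. (u i - c) * (p i - e i))" by (rule sum_nonneg)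
  also have "\<dots> = (\<Sum>i\<in>S. u i * p i) - (\<Sum>i\<in>S. u i * e i) - c * (sum p S - sum e S)"
    by (simp add: algebra_simps sum.distrib sum_subtractf sum_distrib_left)
  finally show ?thesis using e p(3) by simp
qed

section \<open>Orthogonal projections and the key lower bound\<close>

definition orth_proj_onto :: "'a::euclidean_space set \<Rightarrow> ('a \<Rightarrow> 'a) \<Rightarrow> bool" where
  "orth_proj_onto L P \<longleftrightarrow> linear P \<and> range P \<subseteq> L \<and> (\<forall>x\<in>L. P x = x) \<and>
     (\<forall>x y. inner (P x) y = inner x (P y))"

lemma orth_proj_norm_eq:
  assumes "orth_proj_onto L P"
  shows "(norm (P x))\<^sup>2 = inner x (P x)"
proof -
  have "P (P x) = P x" "inner (P x) (P x) = inner x (P (P x))"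
    using assms by (auto simp: orth_proj_onto_def)
  then show ?thesis by (simp add: power2_norm_eq_inner)
qed

lemma orth_proj_norm_le:
  assumes "orth_proj_onto L P"
  shows "norm (P x) \<le> norm x"
proof -
  have "norm (P x) * norm (P x) \<le> norm x * norm (P x)"
    using orth_proj_norm_eq[OF assms, of x] norm_cauchy_schwarz[of x "P x"]
    by (simp add: power2_eq_square)
  then show ?thesis
    by (cases "P x = 0") auto
qed

text \<open>The sum is the trace of \<open>P\<close>. Expanding \<open>P\<close> in an orthonormal
  basis \<open>B\<close> of \<open>L\<close> turns it into a double sum of squared inner products;
  summed over \<open>Basis\<close> first, Parseval gives 1 for each element of
  \<open>B\<close>.\<close>

lemma orth_proj_exists:
  fixes L :: "'a::euclidean_space set"
  assumes "subspace L"
  obtains P where "orth_proj_onto L P" "(\<Sum>e\<in>Basis. (norm (P e))\<^sup>2) = dim L"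
proof -
  obtain B where B: "B \<subseteq> L" "pairwise orthogonal B" "\<And>x. x \<in> B \<Longrightarrow> norm x = 1"
    "independent B" "card B = dim L" "span B = L"
    using orthonormal_basis_subspace[OF assms] by metis
  have fin: "finite B" using B(4) independent_imp_finite by blast
  have ortho: "inner b c = (if b = c then 1 else 0)" if "b \<in> B" "c \<in> B" for b c
    using that B(2,3) by (auto simp: pairwise_def orthogonal_def dot_square_norm)
  define P where "P x = (\<Sum>b\<in>B. inner x b *\<^sub>R b)" for x
  have lin: "linear P"
    unfolding P_def
    by (rule linearI) (simp_all add: inner_add_left scaleR_add_left sum.distrib scaleR_sum_right)
  have id: "P b = b" if "b \<in> B" for b
    unfolding P_def using that fin by (simp add: ortho if_distrib if_distribR cong: if_cong)
  have "P x = x" if "x \<in> L" for x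
    using linear_eq_on_span[OF lin linear_id, of B x] id that B(6) by auto
  moreover have "P x \<in> L" for x
    unfolding P_def using B(1) assms by (intro subspace_sum subspace_scale) auto
  moreover have "inner (P x) y = inner x (P y)" for x y
    by (simp add: P_def inner_sum_left inner_sum_right inner_commute mult.commute)
  ultimately have P: "orth_proj_onto L P" using lin by (auto simp: orth_proj_onto_def)
  have "(\<Sum>e\<in>Basis. (norm (P e))\<^sup>2) = (\<Sum>e\<in>Basis. \<Sum>b\<in>B. (inner e b)\<^sup>2)"
    unfolding orth_proj_norm_eq[OF P]
    by (simp add: P_def inner_sum_right power2_eq_square)
  also have "\<dots> = (\<Sum>b\<in>B. \<Sum>e\<in>Basis. (inner b e)\<^sup>2)"
    by (subst sum.swap) (simp add: inner_commute)
  also have "\<dots> = (\<Sum>b\<in>B. (norm b)\<^sup>2)"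
    unfolding power2_norm_eq_inner euclidean_inner[of b b for b] by (simp add: power2_eq_square)
  also have "\<dots> = dim L" using B(3,5) by simp
  finally show thesis using P that by blast
qed

text \<open>This bound serves both radii. The threshold \<open>c\<close> expresses that
  \<open>T\<close> carries the smallest weights without any order on the index type.\<close>

lemma ex_signed_vector_orth_proj_ge:
  fixes L :: "(real ^ 'n::finite) set" and w :: "'n \<Rightarrow> real"
  assumes L: "subspace L" and T: "card T = dim L" and w0: "\<And>i. 0 \<le> w i"
    and w: "\<And>i. i \<in> T \<Longrightarrow> w i \<le> c" "\<And>i. i \<notin> T \<Longrightarrow> c \<le> w i"
    and c0: "0 \<le> c"
  shows "\<exists>P x. orth_proj_onto L P \<and> (\<forall>i. \<bar>x $ i\<bar> = w i) \<and>
           sqrt (\<Sum>i\<in>T. (w i)\<^sup>2) \<le> norm (P x)"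
proof -
  obtain P where P: "orth_proj_onto L P" and sumP: "(\<Sum>e\<in>Basis. (norm (P e))\<^sup>2) = dim L"
    by (rule orth_proj_exists[OF L])
  have lin: "linear P" using P by (simp add: orth_proj_onto_def)
  define p where "p i = (norm (P (axis i 1)))\<^sup>2" for i
  have Basis_eq: "(Basis :: (real^'n) set) = (\<lambda>i. axis i 1) ` UNIV" by (auto simp: Basis_vec_def)
  have inj: "inj (\<lambda>i. axis i 1 :: real^'n)" by (simp add: inj_on_def axis_eq_axis)
  have "(\<Sum>e\<in>Basis. (norm (P e))\<^sup>2) = sum p UNIV"
    unfolding Basis_eq sum.reindex[OF inj] p_def[abs_def] o_def by (rule refl)
  then have sp: "sum p UNIV = card T" using sumP T by simp
  have p1: "p i \<le> 1" for i
    using orth_proj_norm_le[OF P, of "axis i 1"] by (simp add: p_def power_le_one)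
  \<comment> \<open>The extremal inequality is applied to the squared weights; nonnegativity of
    \<open>w\<close> and \<open>c\<close> lets the threshold pass to squares.\<close>
  have "(\<Sum>i\<in>T. (w i)\<^sup>2) \<le> (\<Sum>i\<in>UNIV. (w i)\<^sup>2 * p i)"
    by (rule sum_smallest_le_weighted_sum[where c = "c\<^sup>2"])
      (use sp p1 w w0 c0 in \<open>auto simp: p_def intro!: power_mono\<close>)
  also have "\<dots> = (\<Sum>i\<in>UNIV. (norm (w i *\<^sub>R P (axis i 1)))\<^sup>2)"
    by (simp add: p_def power_mult_distrib)
  finally have le: "(\<Sum>i\<in>T. (w i)\<^sup>2) \<le> (\<Sum>i\<in>UNIV. (norm (w i *\<^sub>R P (axis i 1)))\<^sup>2)" .
  obtain s :: "'n \<Rightarrow> real" where s: "\<And>i. \<bar>s i\<bar> = 1"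
    "(\<Sum>i\<in>UNIV. (norm (w i *\<^sub>R P (axis i 1)))\<^sup>2)
      \<le> (norm (\<Sum>i\<in>UNIV. s i *\<^sub>R w i *\<^sub>R P (axis i 1)))\<^sup>2"
    using ex_signs_sum_norm_le[of UNIV "\<lambda>i. w i *\<^sub>R P (axis i 1)"] by auto
  define x :: "real^'n" where "x = (\<chi> i. s i * w i)"
  have "x = (\<Sum>i\<in>UNIV. s i *\<^sub>R w i *\<^sub>R axis i 1)"
    by (simp add: x_def vec_eq_iff axis_def if_distrib cong: if_cong)
  then have "P x = (\<Sum>i\<in>UNIV. s i *\<^sub>R w i *\<^sub>R P (axis i 1))"
    using lin by (simp add: linear_sum linear_scale)
  then have "sqrt (\<Sum>i\<in>T. (w i)\<^sup>2) \<le> norm (P x)"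
    using le s(2) by (simp add: real_le_lsqrt)
  moreover have "\<bar>x $ i\<bar> = w i" for i using s(1) w0 by (simp add: x_def abs_mult)
  ultimately show ?thesis using P by blast
qed

section \<open>Directions of flats, and coordinate subspaces\<close>

lemma affine_eq_translated_subspace:
  fixes F :: "'a::euclidean_space set"
  assumes "affine F" "q \<in> F"
  obtains L where "subspace L" "F = (+) q ` L" "aff_dim F = int (dim L)"
proof
  let ?L = "(\<lambda>x. - q + x) ` F"
  show L: "subspace ?L" using affine_diffs_subspace[OF assms] .
  show "F = (+) q ` ?L" by (auto simp: image_image)
  have "aff_dim F = aff_dim ?L" by (simp only: aff_dim_translation_eq)
  then show "aff_dim F = int (dim ?L)" using L by (simp add: aff_dim_subspace)
qed

lemma norm_vec_le_sqrt_sum: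
  fixes x :: "real ^ 'n::finite"
  assumes "\<And>i. i \<in> T \<Longrightarrow> \<bar>x $ i\<bar> \<le> b i" "\<And>i. i \<notin> T \<Longrightarrow> x $ i = 0"
  shows "norm x \<le> sqrt (\<Sum>i\<in>T. (b i)\<^sup>2)"
proof -
  have "(\<Sum>i\<in>UNIV. (x $ i)\<^sup>2) = (\<Sum>i\<in>T. (x $ i)\<^sup>2)"
    using assms(2) by (intro sum.mono_neutral_right) auto
  also have "\<dots> \<le> (\<Sum>i\<in>T. (b i)\<^sup>2)"
    using assms(1) by (intro sum_mono) (metis abs_le_square_iff abs_ge_self order_trans)
  finally show ?thesis by (simp add: norm_vec_def L2_set_def)
qed

definition coord_subspace :: "'n set \<Rightarrow> (real ^ 'n::finite) set" where
  "coord_subspace T = {x. \<forall>i. i \<notin> T \<longrightarrow> x $ i = 0}"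

lemma subspace_coord_subspace: "subspace (coord_subspace T)"
  by (auto simp: coord_subspace_def subspace_def)

lemma dim_coord_subspace:
  fixes T :: "'n::finite set"
  shows "dim (coord_subspace T) = card T"
proof -
  let ?d = "(\<lambda>i. axis i 1) ` T :: (real ^ 'n) set"
  have "coord_subspace T = {x. \<forall>e\<in>Basis. e \<notin> ?d \<longrightarrow> inner x e = 0}"
    by (auto simp: coord_subspace_def Basis_vec_def inner_axis axis_eq_axis image_iff)
  moreover have "card ?d = card T" by (intro card_image) (auto simp: inj_on_def axis_eq_axis)
  moreover have "?d \<subseteq> Basis" by (auto simp: Basis_vec_def)
  ultimately show ?thesis using dim_substandard[of ?d] by simp
qed

section \<open>Outer radius of a box\<close>

text \<open>The flat on which the coordinates in \<open>T\<close> vanish attains the bound.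
  Conversely, projecting along the direction of any admissible flat shrinks that flat to a point, so
  the image of the box lies in a ball of radius \<open>r\<close>; the two images of an opposite pair
  of vertices then force \<open>r\<close> to be large.\<close>

lemma outer_radius_box:
  fixes b :: "'n::finite \<Rightarrow> real"
  assumes b0: "\<And>i. 0 \<le> b i"
    and c: "0 \<le> c" "\<And>i. i \<in> T \<Longrightarrow> b i \<le> c" "\<And>i. i \<notin> T \<Longrightarrow> c \<le> b i"
  shows "outer_radius (card T) {x::real^'n. \<forall>i. \<bar>x $ i\<bar> \<le> b i} = sqrt (\<Sum>i\<in>T. (b i)\<^sup>2)"
    (is "outer_radius _ ?B = ?R")
  unfolding outer_radius_def
proof (rule Least_equality)
  let ?E = "coord_subspace (- T)"
  have "card (- T) = CARD('n) - card T" "card T \<le> CARD('n)"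
    by (simp_all add: Compl_eq_Diff_UNIV card_Diff_subset card_mono)
  then have "aff_dim ?E = int DIM(real^'n) - int (card T)"
    using aff_dim_subspace[OF subspace_coord_subspace, of "- T"]
    by (simp add: dim_coord_subspace of_nat_diff)
  moreover have "x \<in> {x + y |x y. x \<in> ?E \<and> y \<in> cball 0 ?R}" if "x \<in> ?B" for x
  proof -
    define y :: "real^'n" where "y = (\<chi> i. if i \<in> T then x $ i else 0)"
    have "norm y \<le> ?R" using that by (intro norm_vec_le_sqrt_sum) (auto simp: y_def)
    moreover have "x - y \<in> ?E" by (auto simp: coord_subspace_def y_def)
    ultimately show ?thesis by (intro CollectI exI[of _ "x - y"] exI[of _ y]) auto
  qed
  ultimately show "0 \<le> ?R \<and> (\<exists>E. affine E \<and> aff_dim E = int DIM(real^'n) - int (card T) \<and>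
      ?B \<subseteq> {x + y |x y. x \<in> E \<and> y \<in> cball 0 ?R})"
    using subspace_imp_affine[OF subspace_coord_subspace] by (meson real_sqrt_ge_zero subsetI sum_nonneg zero_le_power2)
next
  fix r
  assume "0 \<le> r \<and> (\<exists>E. affine E \<and> aff_dim E = int DIM(real^'n) - int (card T) \<and>
      ?B \<subseteq> {x + y |x y. x \<in> E \<and> y \<in> cball 0 r})"
  then obtain E where E: "affine E" "aff_dim E = int CARD('n) - int (card T)"
    and sub: "?B \<subseteq> {x + y |x y. x \<in> E \<and> y \<in> cball 0 r}" by auto
  \<comment> \<open>A point of the box witnesses that \<open>E\<close> is nonempty, which supplies a
    base point \<open>q\<close>.\<close>
  have "0 \<in> ?B" using b0 by simp
  then obtain q where "q \<in> E" using sub by blast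
  then obtain M where M: "subspace M" "E = (+) q ` M" "aff_dim E = int (dim M)"
    using E(1) affine_eq_translated_subspace by metis
  define L where "L = {y \<in> UNIV. \<forall>x\<in>M. orthogonal x y}"
  have L: "subspace L" unfolding L_def using subspace_orthogonal_to_vectors[of M] by simp
  have "dim L + dim M = CARD('n)"
    unfolding L_def using dim_subspace_orthogonal_to_vectors[OF M(1) subspace_UNIV] by simp
  then have dimL: "card T = dim L" using E(2) M(3) by linarith
  obtain P x where P: "orth_proj_onto L P" and x: "\<And>i. \<bar>x $ i\<bar> = b i"
    and R: "?R \<le> norm (P x)"
    using ex_signed_vector_orth_proj_ge[where w = b, OF L dimL b0 c(2) c(3) c(1)] by blast
  have lin: "linear P" using P by (simp add: orth_proj_onto_def)
  have near: "norm (P y - P q) \<le> r" if yB: "y \<in> ?B" for y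
  proof -
    obtain m z where m: "m \<in> M" and z: "norm z \<le> r" and y: "y = q + m + z"
      using subsetD[OF sub yB] M(2) by auto
    \<comment> \<open>\<open>P\<close> annihilates the direction \<open>M\<close> of the flat:
      \<open>P m\<close> lies in \<open>L\<close>, which is orthogonal to \<open>M\<close>, and the
      squared norm of \<open>P m\<close> is \<open>inner m (P m)\<close>.\<close>
    have "P m \<in> L" using P by (auto simp: orth_proj_onto_def)
    then have "(norm (P m))\<^sup>2 = 0"
      unfolding orth_proj_norm_eq[OF P] using m by (simp add: L_def orthogonal_def)
    then have "P y - P q = P z" using y lin by (simp add: linear_add)
    then show ?thesis using orth_proj_norm_le[OF P, of z] z by simp
  qed
  have "norm (P x - P q) \<le> r" "norm (P (- x) - P q) \<le> r"
    using near[of x] near[of "- x"] x by auto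
  \<comment> \<open>Subtracting the bounds for \<open>x\<close> and \<open>- x\<close> eliminates
    the unknown centre \<open>P q\<close>, so the flat need not pass through the origin.\<close>
  moreover have "2 *\<^sub>R P x = (P x - P q) - (P (- x) - P q)"
    using lin by (simp add: linear_neg scaleR_2)
  then have "2 * norm (P x) \<le> norm (P x - P q) + norm (P (- x) - P q)"
    by (metis norm_scaleR norm_triangle_ineq4 abs_numeral)
  ultimately show "?R \<le> r" using R by linarith
qed

section \<open>Inner radius of a weighted l1 ball\<close>

text \<open>Cauchy-Schwarz shows that the centred ball in the coordinate subspace of
  \<open>T\<close> fits. Conversely, any vector \<open>x\<close> with absolute entries
  \<open>w\<close> bounds the body by the half-space \<open>inner x u \<le> 1\<close>, and some such
  \<open>x\<close> has a long projection to the direction of the given flat.\<close>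

lemma inner_radius_cross:
  fixes w :: "'n::finite \<Rightarrow> real"
  assumes w0: "\<And>i. 0 < w i" and "T \<noteq> {}"
    and c: "\<And>i. i \<in> T \<Longrightarrow> w i \<le> c" "\<And>i. i \<notin> T \<Longrightarrow> c \<le> w i"
  shows "inner_radius (card T) {x::real^'n. (\<Sum>i\<in>UNIV. w i * \<bar>x $ i\<bar>) \<le> 1}
           = 1 / sqrt (\<Sum>i\<in>T. (w i)\<^sup>2)"
    (is "inner_radius _ ?X = 1 / ?W")
  unfolding inner_radius_def
proof (rule Greatest_equality)
  obtain k where "k \<in> T" using assms(2) by auto
  then have "0 < (\<Sum>i\<in>T. (w i)\<^sup>2)" using w0 by (intro sum_pos zero_less_power) auto
  then have W: "0 < ?W" by simp
  {
    let ?F = "coord_subspace T"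
    have "x \<in> ?X" if "norm x \<le> 1 / ?W" "x \<in> ?F" for x
    proof -
      define y :: "real^'n" where "y = (\<chi> i. if i \<in> T then w i else 0)"
      define z :: "real^'n" where "z = (\<chi> i. \<bar>x $ i\<bar>)"
      have "norm z = norm x" by (simp add: norm_vec_def L2_set_def z_def)
      have "norm y \<le> ?W"
        using w0 less_imp_le by (intro norm_vec_le_sqrt_sum) (auto simp: y_def)
      have "(\<Sum>i\<in>UNIV. w i * \<bar>x $ i\<bar>) = inner y z"
        using that(2) unfolding inner_vec_def
        by (intro sum.cong) (auto simp: y_def z_def coord_subspace_def)
      also have "\<dots> \<le> norm y * norm z" by (rule norm_cauchy_schwarz)
      also have "\<dots> \<le> ?W * (1 / ?W)"
        using \<open>norm y \<le> ?W\<close> \<open>norm z = norm x\<close> that(1) W by (intro mult_mono) auto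
      finally show ?thesis using W by simp
    qed
    then have "cball 0 (1 / ?W) \<inter> ?F \<subseteq> ?X" by auto
    moreover have "0 \<in> ?F" by (simp add: coord_subspace_def)
    moreover have "aff_dim ?F = int (card T)"
      using aff_dim_subspace[OF subspace_coord_subspace, of T] by (simp add: dim_coord_subspace)
    ultimately show "0 \<le> 1 / ?W \<and> (\<exists>F q. affine F \<and> aff_dim F = int (card T) \<and> q \<in> F \<and>
        cball q (1 / ?W) \<inter> F \<subseteq> ?X)"
      using subspace_imp_affine[OF subspace_coord_subspace] W
      by (meson divide_nonneg_pos zero_le_one)
  }
  fix r
  assume "0 \<le> r \<and> (\<exists>F q. affine F \<and> aff_dim F = int (card T) \<and> q \<in> F \<and> cball q r \<inter> F \<subseteq> ?X)"
  then obtain F q where r: "0 \<le> r" and F: "affine F" "aff_dim F = int (card T)" "q \<in> F"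
    and sub: "cball q r \<inter> F \<subseteq> ?X" by blast
  obtain L where L: "subspace L" "F = (+) q ` L" "aff_dim F = int (dim L)"
    using F affine_eq_translated_subspace by metis
  have dimL: "card T = dim L" using F(2) L(3) by simp
  have c0: "0 \<le> c" using c(1)[OF \<open>k \<in> T\<close>] w0[of k] by linarith
  obtain P x where P: "orth_proj_onto L P" and x: "\<And>i. \<bar>x $ i\<bar> = w i"
    and R: "?W \<le> norm (P x)"
    using ex_signed_vector_orth_proj_ge[where w = w, OF L(1) dimL less_imp_le[OF w0] c c0] by blast
  \<comment> \<open>Among the vectors of \<open>L\<close> of norm at most \<open>r\<close>, this one
    has the largest inner product with \<open>x\<close>, namely
    \<open>r * norm (P x)\<close>.\<close>
  define y where "y = (r / norm (P x)) *\<^sub>R P x"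
  have Px: "norm (P x) > 0" using R W by linarith
  have y: "y \<in> L" "- y \<in> L" "norm y = r"
    using P L(1) Px r by (auto simp: y_def orth_proj_onto_def intro!: subspace_scale subspace_neg)
  have "q + y \<in> ?X" "q + - y \<in> ?X"
    using y L(2) by (intro subsetD[OF sub]; auto simp: dist_norm)+
  moreover have "inner x u \<le> 1" if "(\<Sum>i\<in>UNIV. w i * \<bar>u $ i\<bar>) \<le> 1" for u
  proof -
    have "inner x u \<le> (\<Sum>i\<in>UNIV. w i * \<bar>u $ i\<bar>)"
      unfolding inner_vec_def using x by (intro sum_mono) (simp flip: x abs_mult)
    then show ?thesis using that by linarith
  qed
  \<comment> \<open>By central symmetry the body also contains \<open>y - q\<close>. Averaging the
    half-space inequalities for \<open>q + y\<close> and \<open>y - q\<close> removes the centre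
    \<open>q\<close>.\<close>
  moreover have "(\<Sum>i\<in>UNIV. w i * \<bar>(- (q + - y)) $ i\<bar>) = (\<Sum>i\<in>UNIV. w i * \<bar>(q + - y) $ i\<bar>)"
    by (simp add: abs_minus_commute)
  ultimately have "inner x (q + y) \<le> 1" "inner x (- (q + - y)) \<le> 1"
    by auto
  then have "inner x y \<le> 1" by (simp add: inner_add_right inner_diff_right)
  moreover have "inner x y = r * norm (P x)"
    using orth_proj_norm_eq[OF P, of x] Px by (simp add: y_def power2_eq_square field_simps)
  ultimately have "r * ?W \<le> 1" using mult_left_mono[OF R r] by linarith
  then show "r \<le> 1 / ?W" using W by (simp add: field_simps)
qed

section \<open>The cross-polytope as a weighted l1 ball, and the closed form of its radius\<close>

text \<open>The l1 ball is convex and contains the vertices. Conversely, a point of it is a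
  combination of suitably signed vertices with coefficients \<open>\<bar>x $ i\<bar> / b i\<close>;
  their total is at most 1, and the missing mass is placed at the origin.\<close>

lemma convex_hull_signed_axes:
  fixes b :: "'n::finite \<Rightarrow> real"
  assumes b0: "\<And>i. 0 < b i"
  shows "convex hull (\<Union>i. {b i *\<^sub>R axis i 1, - (b i *\<^sub>R axis i 1)})
    = {x::real^'n. (\<Sum>i\<in>UNIV. 1 / b i * \<bar>x $ i\<bar>) \<le> 1}" (is "convex hull ?V = ?X")
proof
  have "convex ?X"
  proof (rule convexI)
    fix x y :: "real^'n" and u v :: real
    assume xy: "x \<in> ?X" "y \<in> ?X" and uv: "0 \<le> u" "0 \<le> v" "u + v = 1"
    have "(\<Sum>i\<in>UNIV. 1 / b i * \<bar>(u *\<^sub>R x + v *\<^sub>R y) $ i\<bar>)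
      \<le> (\<Sum>i\<in>UNIV. u * (1 / b i * \<bar>x $ i\<bar>) + v * (1 / b i * \<bar>y $ i\<bar>))"
    proof (rule sum_mono)
      fix i
      have "\<bar>u * x $ i + v * y $ i\<bar> \<le> u * \<bar>x $ i\<bar> + v * \<bar>y $ i\<bar>"
        using uv abs_triangle_ineq[of "u * x $ i" "v * y $ i"] by (simp add: abs_mult)
      then have "1 / b i * \<bar>u * x $ i + v * y $ i\<bar> \<le> 1 / b i * (u * \<bar>x $ i\<bar> + v * \<bar>y $ i\<bar>)"
        using b0[of i] by (intro mult_left_mono) auto
      then show "1 / b i * \<bar>(u *\<^sub>R x + v *\<^sub>R y) $ i\<bar>
          \<le> u * (1 / b i * \<bar>x $ i\<bar>) + v * (1 / b i * \<bar>y $ i\<bar>)"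
        by (simp add: algebra_simps)
    qed
    also have "\<dots> = u * (\<Sum>i\<in>UNIV. 1 / b i * \<bar>x $ i\<bar>) + v * (\<Sum>i\<in>UNIV. 1 / b i * \<bar>y $ i\<bar>)"
      by (simp only: sum.distrib sum_distrib_left)
    also have "\<dots> \<le> 1" using xy uv by (intro convex_bound_le) auto
    finally show "u *\<^sub>R x + v *\<^sub>R y \<in> ?X" by simp
  qed
  moreover have "?V \<subseteq> ?X"
  proof
    fix v assume "v \<in> ?V"
    then obtain k where "v = b k *\<^sub>R axis k 1 \<or> v = - (b k *\<^sub>R axis k 1)" by auto
    then have "1 / b i * \<bar>v $ i\<bar> = (if i = k then 1 else 0)" for i
      using b0[of k] by (auto simp: axis_def)
    then show "v \<in> ?X" by simp
  qed
  ultimately show "convex hull ?V \<subseteq> ?X" by (rule hull_minimal[rotated])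
next
  show "?X \<subseteq> convex hull ?V"
  proof
    fix x assume x: "x \<in> ?X"
    have V: "b i *\<^sub>R axis i 1 \<in> convex hull ?V" "- (b i *\<^sub>R axis i 1) \<in> convex hull ?V" for i
      by (rule hull_inc, blast)+
    \<comment> \<open>The origin is the midpoint of two opposite vertices.\<close>
    have "(1/2) *\<^sub>R (b i *\<^sub>R axis i 1) + (1/2) *\<^sub>R - (b i *\<^sub>R axis i 1) \<in> convex hull ?V" for i
      by (rule convexD[OF convex_convex_hull V]) auto
    then have zero: "0 \<in> convex hull ?V" by simp
    define t where "t i = 1 / b i * \<bar>x $ i\<bar>" for i
    define v :: "'n \<Rightarrow> real^'n"
      where "v i = (if x $ i \<ge> 0 then b i *\<^sub>R axis i 1 else - (b i *\<^sub>R axis i 1))" for i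
    have tv: "t i *\<^sub>R v i = x $ i *\<^sub>R axis i 1" for i
      using b0[of i] by (auto simp: t_def v_def)
    define s where "s = sum t UNIV"
    have t0: "0 \<le> t i" for i using b0[of i] by (simp add: t_def)
    have s: "0 \<le> s" "s \<le> 1" using x t0 by (auto simp: s_def t_def intro: sum_nonneg)
    have "(\<Sum>i\<in>UNIV. t i *\<^sub>R v i) = x"
      by (simp add: tv vec_eq_iff axis_def if_distrib cong: if_cong)
    moreover have "(\<Sum>i\<in>UNIV. t i *\<^sub>R v i) \<in> convex hull ?V"
    \<comment> \<open>For positive \<open>s\<close> the coefficients are normalised to total 1, and
      the resulting point is then contracted towards the origin by the factor
      \<open>s\<close>.\<close>
    proof (cases "s = 0")
      case True
      then have "t i = 0" for i using t0 by (simp add: s_def sum_nonneg_eq_0_iff)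
      then show ?thesis using zero by simp
    next
      case False
      have "(\<Sum>i\<in>UNIV. (t i / s) *\<^sub>R v i) \<in> convex hull ?V"
        using False s t0 V
        by (intro convex_sum) (auto simp: v_def convex_convex_hull simp flip: sum_divide_distrib s_def)
      then have "s *\<^sub>R (\<Sum>i\<in>UNIV. (t i / s) *\<^sub>R v i) + (1 - s) *\<^sub>R 0 \<in> convex hull ?V"
        using zero s by (intro convexD[OF convex_convex_hull]) auto
      then show ?thesis using False by (simp add: scaleR_sum_right)
    qed
    ultimately show "x \<in> convex hull ?V" by simp
  qed
qed

text \<open>Each product omitting one index is the full product divided by the omitted factor, so
  the squared full product factors out of the sum and cancels against the numerator.\<close>

lemma prod_div_sqrt_sum_prod_eq:
  fixes f :: "'i \<Rightarrow> real"
  assumes "finite S" and f: "\<And>i. i \<in> S \<Longrightarrow> 0 < f i"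
  shows "prod f S / sqrt (\<Sum>i\<in>S. \<Prod>l\<in>S - {i}. (f l)\<^sup>2) = 1 / sqrt (\<Sum>i\<in>S. (1 / f i)\<^sup>2)"
proof -
  have pos: "0 < prod f S" using f by (rule prod_pos)
  have "(\<Prod>l\<in>S - {i}. (f l)\<^sup>2) = (prod f S)\<^sup>2 * (1 / f i)\<^sup>2" if "i \<in> S" for i
    using f[OF that] prod.remove[OF assms(1) that, of "\<lambda>l. (f l)\<^sup>2"]
    by (simp add: prod_power_distrib field_simps)
  then have "(\<Sum>i\<in>S. \<Prod>l\<in>S - {i}. (f l)\<^sup>2) = (prod f S)\<^sup>2 * (\<Sum>i\<in>S. (1 / f i)\<^sup>2)"
    by (simp add: sum_distrib_left)
  then show ?thesis using pos by (simp add: real_sqrt_mult)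
qed

section \<open>Transfer to the numbered coordinates\<close>

theorem theorem3p3:
  fixes d j :: nat and a :: "nat \<Rightarrow> real" and \<sigma> :: "nat \<Rightarrow> 'n::finite"
  assumes "d = CARD('n)" and "d \<ge> 2"
    and "bij_betw \<sigma> {1..d} (UNIV :: 'n set)"
    and "0 < a 1" and "mono_on {1..d} a"
    and "j \<in> {1..d}"
  shows "outer_radius j (coord_box \<sigma> a) = sqrt (\<Sum>i=1..j. (a i)\<^sup>2)
    \<and> inner_radius j (cross_polytope \<sigma> a) =
        (\<Prod>i=d-j+1..d. a i) / sqrt (\<Sum>i=d-j+1..d. \<Prod>l\<in>{d-j+1..d} - {i}. (a l)\<^sup>2)"
proof -
  have inj: "inj_on \<sigma> {1..d}" and im: "\<sigma> ` {1..d} = UNIV"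
    using assms(3) by (auto simp: bij_betw_def)
  \<comment> \<open>\<open>b\<close> carries the half-lengths from numbers over to coordinates,
    where the preceding lemmas apply.\<close>
  define b where "b = a \<circ> inv_into {1..d} \<sigma>"
  have b: "b (\<sigma> i) = a i" if "i \<in> {1..d}" for i
    using inv_into_f_f[OF inj that] by (simp add: b_def)
  have mono: "a i \<le> a k" if "i \<in> {1..d}" "k \<in> {1..d}" "i \<le> k" for i k
    using assms(5) that by (auto simp: mono_on_def)
  have apos: "0 < a i" if "i \<in> {1..d}" for i
    using mono[of 1 i] that assms(2,4) by auto
  \<comment> \<open>Since \<open>\<sigma>\<close> is onto, statements about all coordinates can be
    checked on numbers, where monotonicity of \<open>a\<close> is available.\<close>
  have all: "(\<forall>k. Q k) \<longleftrightarrow> (\<forall>i\<in>{1..d}. Q (\<sigma> i))" for Q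
    using im by (metis UNIV_I imageE)
  have bpos: "0 < b k" for k
  proof -
    have "\<forall>k. 0 < b k" using b apos by (subst all) auto
    then show ?thesis ..
  qed
  have inj_on_sub: "inj_on \<sigma> S" if "S \<subseteq> {1..d}" for S
    using inj that by (rule inj_on_subset)
  have img: "\<sigma> i \<in> \<sigma> ` S \<longleftrightarrow> i \<in> S" if "S \<subseteq> {1..d}" "i \<in> {1..d}" for S i
    using inj_on_image_mem_iff[OF inj that(2,1)] .
  have "coord_box \<sigma> a = {x. \<forall>i. \<bar>x $ i\<bar> \<le> b i}"
    unfolding coord_box_def all assms(1)[symmetric]
    using b by (intro Collect_cong ball_cong) (auto simp: abs_le_iff)
  moreover have "outer_radius (card (\<sigma> ` {1..j})) {x. \<forall>i. \<bar>x $ i\<bar> \<le> b i}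
      = sqrt (\<Sum>i\<in>\<sigma> ` {1..j}. (b i)\<^sup>2)"
  \<comment> \<open>The \<open>j\<close> smallest half-lengths are those numbered 1 to
    \<open>j\<close>, and \<open>a j\<close> separates them from the rest.\<close>
  proof (rule outer_radius_box[where c = "a j"])
    show "0 \<le> b i" for i using bpos[of i] by simp
    show "0 \<le> a j" using apos[OF assms(6)] by simp
    have "\<forall>k. (k \<in> \<sigma> ` {1..j} \<longrightarrow> b k \<le> a j) \<and> (k \<notin> \<sigma> ` {1..j} \<longrightarrow> a j \<le> b k)"
      unfolding all
    proof
      fix i assume i: "i \<in> {1..d}"
      have S: "{1..j} \<subseteq> {1..d}" using assms(6) by auto
      show "(\<sigma> i \<in> \<sigma> ` {1..j} \<longrightarrow> b (\<sigma> i) \<le> a j) \<and> (\<sigma> i \<notin> \<sigma> ` {1..j} \<longrightarrow> a j \<le> b (\<sigma> i))"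
        unfolding img[OF S i] b[OF i] using i mono[OF i assms(6)] mono[OF assms(6) i] by auto
    qed
    then show "\<And>i. i \<in> \<sigma> ` {1..j} \<Longrightarrow> b i \<le> a j" "\<And>i. i \<notin> \<sigma> ` {1..j} \<Longrightarrow> a j \<le> b i" by auto
  qed
  moreover have "(\<Sum>i\<in>\<sigma> ` {1..j}. (b i)\<^sup>2) = (\<Sum>i=1..j. (a i)\<^sup>2)" "card (\<sigma> ` {1..j}) = j"
    using assms(6) inj_on_sub[of "{1..j}"] by (simp_all add: sum.reindex card_image b)
  ultimately have outer: "outer_radius j (coord_box \<sigma> a) = sqrt (\<Sum>i=1..j. (a i)\<^sup>2)" by simp

  \<comment> \<open>Reciprocals reverse the order: the \<open>j\<close> smallest weights belong to
    the \<open>j\<close> largest entries of \<open>a\<close>. Because \<open>j \<le> d\<close>,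
    \<open>?S\<close> has exactly \<open>j\<close> elements, and its first index
    \<open>d-j+1\<close> provides the threshold.\<close>
  let ?S = "{d-j+1..d}" and ?w = "\<lambda>k. 1 / b k"
  have S: "?S \<subseteq> {1..d}" by auto
  have m: "d-j+1 \<in> {1..d}" using assms(6) by auto
  have "cross_polytope \<sigma> a
      = convex hull (\<Union>k\<in>\<sigma> ` {1..d}. {b k *\<^sub>R axis k 1, - (b k *\<^sub>R axis k 1)})"
    unfolding cross_polytope_def using assms(1) b by (intro arg_cong[where f = "\<lambda>S. convex hull S"]) simp
  then have "cross_polytope \<sigma> a = {x. (\<Sum>i\<in>UNIV. ?w i * \<bar>x $ i\<bar>) \<le> 1}"
    unfolding im using convex_hull_signed_axes[OF bpos] by simp
  moreover have "inner_radius (card (\<sigma> ` ?S)) {x. (\<Sum>i\<in>UNIV. ?w i * \<bar>x $ i\<bar>) \<le> 1}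
      = 1 / sqrt (\<Sum>i\<in>\<sigma> ` ?S. (?w i)\<^sup>2)"
  proof (rule inner_radius_cross[where c = "1 / a (d-j+1)"])
    show "0 < ?w i" for i using bpos by simp
    show "\<sigma> ` ?S \<noteq> {}" using assms(6) by auto
    have "\<forall>k. (k \<in> \<sigma> ` ?S \<longrightarrow> a (d-j+1) \<le> b k) \<and> (k \<notin> \<sigma> ` ?S \<longrightarrow> b k \<le> a (d-j+1))"
      unfolding all
    proof
      fix i assume i: "i \<in> {1..d}"
      show "(\<sigma> i \<in> \<sigma> ` ?S \<longrightarrow> a (d-j+1) \<le> b (\<sigma> i)) \<and> (\<sigma> i \<notin> \<sigma> ` ?S \<longrightarrow> b (\<sigma> i) \<le> a (d-j+1))"
        unfolding img[OF S i] b[OF i] using i mono[OF i m] mono[OF m i] by auto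
    qed
    then show "\<And>i. i \<in> \<sigma> ` ?S \<Longrightarrow> ?w i \<le> 1 / a (d-j+1)"
      "\<And>i. i \<notin> \<sigma> ` ?S \<Longrightarrow> 1 / a (d-j+1) \<le> ?w i"
      using apos[OF m] bpos by (meson divide_left_mono mult_pos_pos zero_le_one)+
  qed
  moreover have "(\<Sum>i\<in>\<sigma> ` ?S. (?w i)\<^sup>2) = (\<Sum>i\<in>?S. (1 / a i)\<^sup>2)" "card (\<sigma> ` ?S) = j"
    using assms(6) inj_on_sub[OF S] by (simp_all add: sum.reindex card_image b)
  moreover have "prod a ?S / sqrt (\<Sum>i\<in>?S. \<Prod>l\<in>?S - {i}. (a l)\<^sup>2) = 1 / sqrt (\<Sum>i\<in>?S. (1 / a i)\<^sup>2)"
    using apos S by (intro prod_div_sqrt_sum_prod_eq) auto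
  ultimately show ?thesis using outer by simp
qed

end
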